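(* Let $q$ be a prime power, let $\phi(x)\in\mathbb{F}_{q}[x]$, let $d$ be a positive divisor of $q-1$ and let $r$ be an even positive integer. Let $u,e\in\mathbb{F}_{q}$ and let $c\in\mathbb{F}_{q^2}$ with $c+c^q=0$. Then $$f(x)=(x^{q}-x+c)^r\,\phi\big((x^{q}-x+c)^{(q^2-1)/d}\big)+ux^{q}+(u+e)x$$ is a permutation polynomial of $\mathbb{F}_{q^2}$ if and only if $e(2u+e)\neq 0$.
   Context: A polynomial is a permutation polynomial of $\mathbb{F}_{q^2}$ if the map it induces on $\mathbb{F}_{q^2}$ is a bijection. $\mathbb{F}_q$ is regarded as a subfield of $\mathbb{F}_{q^2}$. *)

theory Defs
  imports
    "HOL-Algebra.Algebraic_Closure_Type"
    "HOL-Number_Theory.Prime_Powers"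
    "HOL-Computational_Algebra.Polynomial"
begin

definition permutation_polynomial :: "'a :: finite_field poly \<Rightarrow> bool" where
  "permutation_polynomial f \<longleftrightarrow> bij (poly f)"

end

theory Submission
  imports Defs "HOL-Number_Theory.Residues"
begin

text \<open>
  Put t = x^q - x + c. Then t^q = -t, so t^2 and t^(q+1) = -t^2 are fixed by the q-power
  Frobenius map, and hence so is the first summand h(t) of f(x), since r is even and
  (q^2 - 1)/d is a multiple of q + 1. Consequently f(x)^q - f(x) = e (x^q - x). If e = 0, all
  values of f are roots of X^q - X, so f is not surjective. If 2u + e = 0, then f(0) = f(1). If
  neither vanishes, f(x) determines x^q - x, hence h(t); two preimages x, y of the same value
  then satisfy (x - y)^q = x - y and (2u + e)(x - y) = 0.
\<close>

text \<open>Multiplication by a nonzero \<open>x\<close> permutes the nonzero elements of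
  \<open>K\<close>; comparing the products over them gives \<open>x ^ (card K - 1) = 1\<close>. For
  the subfield of order \<open>q\<close> this shows that \<open>u\<close>, \<open>e\<close> and the
  coefficients of \<open>\<phi>\<close> are fixed by the \<open>q\<close>-power map.\<close>

lemma power_card_eq_same_of_mult_closed:
  fixes K :: "'a :: field set"
  assumes "finite K" and "0 \<in> K" and closed: "\<And>a b. a \<in> K \<Longrightarrow> b \<in> K \<Longrightarrow> a * b \<in> K"
    and "x \<in> K"
  shows "x ^ card K = x"
proof (cases "x = 0")
  case True
  then show ?thesis
    using assms by (auto simp: power_0_left card_gt_0_iff)
next
  case False
  let ?U = "K - {0}"
  have inj: "inj_on ((*) x) ?U"
    using False by (auto intro: inj_onI)
  have "(*) x ` ?U = ?U"
    by (rule card_subset_eq) (use assms False inj in \<open>auto simp: card_image\<close>)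
  then have "\<Prod>?U = (\<Prod>y\<in>?U. x * y)"
    using prod.reindex[OF inj, of id] by simp
  also have "\<dots> = x ^ card ?U * \<Prod>?U"
    by (simp add: prod.distrib)
  finally have "x ^ card ?U = 1"
    using assms by simp
  moreover have "card K = Suc (card ?U)"
    using assms by (intro card.remove)
  ultimately show ?thesis
    by simp
qed

text \<open>The characteristic is a prime dividing the order of the field, a power of the prime
  under \<open>q\<close>, so the two primes agree. This makes the \<open>q\<close>-power map
  additive.\<close>

lemma primepow_eq_CHAR_power:
  assumes "primepow q" and "card (UNIV :: 'a :: finite_field set) = q ^ n"
  obtains k where "q = CHAR('a) ^ k"
proof -
  obtain p k where pk: "prime p" "k > 0" "q = p ^ k"
    using assms unfolding primepow_def by auto
  have "CHAR('a) dvd p ^ (k * n)"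
    using CHAR_dvd_CARD[where 'a = 'a] assms pk by (simp add: power_mult)
  then have "CHAR('a) dvd p"
    using prime_dvd_power CHAR_prime by blast
  then have "CHAR('a) = p"
    using pk primes_dvd_imp_eq CHAR_prime by blast
  with pk that show thesis by blast
qed

lemma power_diff_of_power_add:
  fixes x y :: "'a :: comm_ring_1"
  assumes add: "\<And>a b :: 'a. (a + b) ^ q = a ^ q + b ^ q"
  shows "(x - y) ^ q = x ^ q - y ^ q"
  using add[of "x - y" y] by (simp add: algebra_simps)

text \<open>An additive power map is a ring endomorphism, so it commutes with evaluation of a
  polynomial whose coefficients it fixes. The zero polynomial needs \<open>0 ^ q = 0\<close>, hence
  \<open>q > 0\<close>.\<close>

lemma poly_power_eq:
  fixes p :: "'a :: comm_semiring_1 poly"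
  assumes add: "\<And>a b :: 'a. (a + b) ^ q = a ^ q + b ^ q" and "q > 0"
    and "\<And>a. a \<in> set (coeffs p) \<Longrightarrow> a ^ q = a"
  shows "poly p z ^ q = poly p (z ^ q)"
  using assms(3)
proof (induction p)
  case 0
  then show ?case
    using \<open>q > 0\<close> by (simp add: power_0_left)
next
  case (pCons a p)
  have "a ^ q = a"
    using pCons by (cases "p = 0 \<and> a = 0") (auto simp: cCons_def)
  moreover have "b ^ q = b" if "b \<in> set (coeffs p)" for b
    using pCons.prems[of b] that pCons.hyps by (auto simp: cCons_def)
  ultimately show ?case
    using pCons.IH by (simp add: add power_mult_distrib)
qed

text \<open>Otherwise every field element would be a root of X^q - X, a polynomial of degree
  \<open>q\<close>; since \<open>1 < q\<close>, its two monomials do not cancel.\<close>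

lemma exists_power_neq_self:
  fixes q :: nat
  assumes "1 < q" and "q < card (UNIV :: 'a :: {idom, finite} set)"
  shows "\<exists>x :: 'a. x ^ q \<noteq> x"
proof (rule ccontr)
  assume "\<nexists>x :: 'a. x ^ q \<noteq> x"
  moreover define p :: "'a poly" where "p = monom 1 q - monom 1 1"
  ultimately have "{x. poly p x = 0} = UNIV"
    by (auto simp: poly_monom)
  moreover have "coeff p q = 1"
    using assms by (simp add: p_def)
  then have "p \<noteq> 0"
    by auto
  moreover have "degree p \<le> q"
    using assms unfolding p_def
    by (intro degree_diff_le) (auto intro: order.trans[OF degree_monom_le])
  ultimately show False
    using card_poly_roots_bound[of p] assms by simp
qed

theorem corollary15:
  fixes q d r :: nat
    and K :: "'a :: finite_field set"
    and \<phi> :: "'a poly"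
    and u e c :: 'a
  assumes "primepow q"
    and "card (UNIV :: 'a set) = q\<^sup>2"
    and "subfield K (ring_of_type_algebra :: 'a ring)"
    and "card K = q"
    and "set (coeffs \<phi>) \<subseteq> K"
    and "d > 0" and "d dvd q - 1"
    and "r > 0" and "even r"
    and "u \<in> K" and "e \<in> K"
    and "c + c ^ q = 0"
  shows "let g = monom 1 q - monom 1 1 + [:c:];
             f = g ^ r * pcompose \<phi> (g ^ ((q\<^sup>2 - 1) div d)) + smult u (monom 1 q) + smult (u + e) (monom 1 1)
         in permutation_polynomial f \<longleftrightarrow> e * (2 * u + e) \<noteq> 0"
proof -
  have q1: "q > 1"
    using \<open>primepow q\<close> primepow_gt_Suc_0 by auto
  obtain k where "q = CHAR('a) ^ k"
    using primepow_eq_CHAR_power assms(1,2) by blast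
  then have add: "(a + b) ^ q = a ^ q + b ^ q" for a b :: 'a
    by (simp add: freshmans_dream')
  have diff: "(a - b) ^ q = a ^ q - b ^ q" for a b :: 'a
    by (rule power_diff_of_power_add[OF add])
  have frob2: "(x ^ q) ^ q = x" for x :: 'a
    using finite_field_power_card_eq_same[of x] assms(2)
    by (simp add: power2_eq_square power_mult)
  note K = subringE[OF subfieldE(1)[OF assms(3)]]
  have K_fixed: "a ^ q = a" if "a \<in> K" for a
    using power_card_eq_same_of_mult_closed[of K a] K(2,6) that \<open>card K = q\<close>
    by (simp add: ring_of_type_algebra_def)

  define t where "t x = x ^ q - x + c" for x :: 'a
  define s where "s = (q\<^sup>2 - 1) div d"
  define h where "h x = t x ^ r * poly \<phi> (t x ^ s)" for x
  define F where "F x = h x + u * x ^ q + (u + e) * x" for x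

  have "q\<^sup>2 - 1 = (q + 1) * (q - 1)"
    by (simp add: power2_eq_square algebra_simps)
  then have s: "s = (q + 1) * ((q - 1) div d)"
    unfolding s_def using \<open>d dvd q - 1\<close> by (simp add: div_mult_swap)
  \<comment> \<open>By \<open>frob2\<close> the power is \<open>x - x ^ q + c ^ q\<close>, and
    \<open>c ^ q = - c\<close>.\<close>
  have t_frob: "t x ^ q = - t x" for x
    unfolding t_def using \<open>c + c ^ q = 0\<close>
    by (simp add: add diff frob2 algebra_simps add_eq_0_iff)
  have fixed_power: "(a ^ m) ^ q = a ^ m" if "a ^ q = a" for a :: 'a and m
  proof -
    have "(a ^ m) ^ q = (a ^ q) ^ m"
      by (simp only: power_mult[symmetric] mult.commute)
    then show ?thesis
      by (simp only: that)
  qed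
  have t_sq: "(t x ^ 2) ^ q = t x ^ 2" for x
  proof -
    have "(t x ^ 2) ^ q = (t x ^ q) ^ 2"
      by (simp only: power2_eq_square power_mult_distrib)
    then show ?thesis
      by (simp add: t_frob)
  qed
  have t_r: "(t x ^ r) ^ q = t x ^ r" for x
    using fixed_power[OF t_sq] \<open>even r\<close> by (metis evenE power_mult)
  have t_s: "(t x ^ s) ^ q = t x ^ s" for x
  proof -
    have "t x ^ (q + 1) = - (t x ^ 2)"
      by (simp add: t_frob power2_eq_square)
    \<comment> \<open>Writing the negative as a difference from 0 avoids a case split on the parity
      of \<open>q\<close>.\<close>
    moreover have "(- (t x ^ 2)) ^ q = - (t x ^ 2)"
      using diff[of 0 "t x ^ 2"] t_sq q1 by (simp add: power_0_left)
    ultimately have "(t x ^ (q + 1)) ^ q = t x ^ (q + 1)"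
      by (simp only:)
    then show ?thesis
      unfolding s power_mult by (rule fixed_power)
  qed
  have h_frob: "h x ^ q = h x" for x
    unfolding h_def power_mult_distrib t_r
    by (subst poly_power_eq) (use add q1 K_fixed assms(5) t_s in auto)
  \<comment> \<open>Here \<open>F x ^ q = h x + u * x + (u + e) * x ^ q\<close>: the
    \<open>h\<close> terms cancel, and so do the \<open>u\<close> terms.\<close>
  have F_frob: "F x ^ q - F x = e * (x ^ q - x)" for x
    using K_fixed[OF \<open>u \<in> K\<close>] K_fixed[OF \<open>e \<in> K\<close>]
    unfolding F_def by (simp add: add power_mult_distrib h_frob frob2 algebra_simps)

  have "bij F \<longleftrightarrow> e * (2 * u + e) \<noteq> 0"
  proof
    assume "bij F"
    have "e \<noteq> 0"
    proof
      assume "e = 0"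
      then have "F x ^ q = F x" for x
        using F_frob[of x] by simp
      then have "y ^ q = y" for y :: 'a
        using bij_is_surj[OF \<open>bij F\<close>] by (metis surjD)
      moreover have "q < q\<^sup>2"
        using q1 by (simp add: power2_eq_square)
      ultimately show False
        using exists_power_neq_self[where 'a = 'a, of q] q1 assms(2) by auto
    qed
    moreover have "2 * u + e \<noteq> 0"
    proof
      assume "2 * u + e = 0"
      \<comment> \<open>Both \<open>t 1\<close> and \<open>t 0\<close> equal \<open>c\<close>, so
        the \<open>h\<close> parts agree and \<open>F 1 - F 0 = 2 * u + e\<close>.\<close>
      then have "F 1 = F 0"
        using q1 by (simp add: F_def h_def t_def power_0_left algebra_simps)
      then show False
        using injD[OF bij_is_inj[OF \<open>bij F\<close>], of 1 0] by simp
    qed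
    ultimately show "e * (2 * u + e) \<noteq> 0"
      by simp
  next
    assume ne: "e * (2 * u + e) \<noteq> 0"
    have "inj F"
    proof (rule injI)
      fix x y
      assume eq: "F x = F y"
      then have "x ^ q - x = y ^ q - y"
        using F_frob[of x] F_frob[of y] ne by auto
      \<comment> \<open>The second fact removes \<open>h\<close> from \<open>F x = F y\<close>; the
        first turns the remaining linear relation into a multiple of \<open>x - y\<close>.\<close>
      then have xy: "x ^ q - y ^ q = x - y" and "t x = t y"
        by (simp_all add: t_def algebra_simps)
      then have "u * (x ^ q - y ^ q) + (u + e) * (x - y) = 0"
        using eq by (simp add: F_def h_def algebra_simps)
      then have "(2 * u + e) * (x - y) = 0"
        unfolding xy by (simp add: algebra_simps)
      then show "x = y"
        using ne by simp
    qed
    then show "bij F"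
      by (simp add: bij_def finite_UNIV_inj_surj)
  qed
  moreover have "poly (g ^ r * pcompose \<phi> (g ^ s) + smult u (monom 1 q) + smult (u + e) (monom 1 1)) = F"
    if "g = monom 1 q - monom 1 1 + [:c:]" for g
    by (rule ext) (simp add: that F_def h_def t_def poly_pcompose poly_monom)
  ultimately show ?thesis
    unfolding permutation_polynomial_def Let_def s_def by simp
qed

end
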